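(* Let $\eta=\eta(x,x_0,y_0)$ be an expression (a term in the language of loops) in the variables $x,x_0,y_0$ in which $x$ appears exactly once, and let $G$ be a loop in the variety $V(\eta)$. Then the map $\Phi:\operatorname{Aut}(G)\times G^2\to\operatorname{Atp}(G)$ which sends $(h,x_0,y_0)$ to the triple of maps $$\Phi(h,x_0,y_0)=\bigl(x\mapsto \eta(h(x),x_0,y_0)/y_0,\;\; y\mapsto x_0\backslash \eta(h(y),x_0,y_0),\;\; z\mapsto \eta(h(z),x_0,y_0)\bigr)$$ is a bijection. Equip $\operatorname{Aut}(G)\times G^2$ with the multiplication $(h_0,x_0,y_0)(h_1,x_1,y_1)=(h_2,x_2,y_2)$, where, with $\varphi_0:x\mapsto\eta(h_0(x),x_0,y_0)$ and $\varphi_1:x\mapsto\eta(h_1(x),x_1,y_1)$, $$x_2=\varphi_0(x_1)/y_0,\qquad y_2=x_0\backslash\varphi_0(y_1),\qquad \varphi_2:x\mapsto \eta(x,x_2,y_2),\qquad h_2=\varphi_2^{-1}\circ\varphi_0\circ\varphi_1 .$$ Then $\Phi$ becomes an isomorphism. Moreover, $\Phi^{-1}$ is given by $$\Phi^{-1}(\alpha,\beta,\gamma)=(h_0^{-1}\circ\gamma,\ \alpha(1),\ \beta(1)),$$ where $h_0$ is defined by $h_0(x)=\eta(x,\alpha(1),\beta(1))$.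
   Context: A quasigroup is an algebra $\langle Q,\cdot,\backslash,/\rangle$ satisfying the identities $x\backslash(x\cdot y)=y$, $(x\cdot y)/y=x$, $x\cdot(x\backslash y)=y$, $(x/y)\cdot y=x$. A loop is an algebra $\langle Q,\cdot,\backslash,/,1\rangle$ such that $\langle Q,\cdot,\backslash,/\rangle$ is a quasigroup and $x\cdot 1=1\cdot x=x$. An autotopism of a loop $(G,\cdot)$ is a triple $(\alpha,\beta,\gamma)$ of bijections $G\to G$ such that $\alpha(x)\cdot\beta(y)=\gamma(x\cdot y)$ for all $x,y\in G$. $\operatorname{Atp}(G)$ is the group of all autotopisms of $G$ under componentwise composition $(\alpha,\beta,\gamma)(\alpha',\beta',\gamma')=(\alpha\circ\alpha',\beta\circ\beta',\gamma\circ\gamma')$, and $\operatorname{Aut}(G)$ is the group of all automorphisms of $G$. For a term $\eta=\eta(x,x_0,y_0)$ in which $x$ appears exactly once (e.g. $\eta=x_0\cdot(x\cdot y_0)$), let $i(\eta)$ be the identity (in the variables $x,y,x_0,y_0$) $$\bigl(\eta(x,x_0,y_0)/y_0\bigr)\cdot\bigl(x_0\backslash\eta(y,x_0,y_0)\bigr)=\eta(x\cdot y,x_0,y_0).$$ $V(\eta)$ denotes the variety of all loops satisfying the identity $i(\eta)$. *)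

theory Defs
  imports "HOL-Algebra.Bij"
begin

text \<open>
  The record extends \<open>monoid\<close> only to reuse its fields \<open>carrier\<close>, \<open>mult\<close>, \<open>one\<close> (and with them
  \<^const>\<open>auto\<close>); associativity is not assumed.
\<close>

record 'a loop = "'a monoid" +
  ldiv :: "['a, 'a] \<Rightarrow> 'a" (infixl "\<setminus>\<index>" 70)
  rdiv :: "['a, 'a] \<Rightarrow> 'a" (infixl "\<oslash>\<index>" 70)

locale quasigroup =
  fixes G (structure)
  assumes mult_closed: "\<lbrakk>x \<in> carrier G; y \<in> carrier G\<rbrakk> \<Longrightarrow> x \<otimes> y \<in> carrier G"
    and ldiv_closed: "\<lbrakk>x \<in> carrier G; y \<in> carrier G\<rbrakk> \<Longrightarrow> x \<setminus> y \<in> carrier G"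
    and rdiv_closed: "\<lbrakk>x \<in> carrier G; y \<in> carrier G\<rbrakk> \<Longrightarrow> x \<oslash> y \<in> carrier G"
    and ldiv_mult: "\<lbrakk>x \<in> carrier G; y \<in> carrier G\<rbrakk> \<Longrightarrow> x \<setminus> (x \<otimes> y) = y"
    and mult_rdiv: "\<lbrakk>x \<in> carrier G; y \<in> carrier G\<rbrakk> \<Longrightarrow> (x \<otimes> y) \<oslash> y = x"
    and mult_ldiv: "\<lbrakk>x \<in> carrier G; y \<in> carrier G\<rbrakk> \<Longrightarrow> x \<otimes> (x \<setminus> y) = y"
    and rdiv_mult: "\<lbrakk>x \<in> carrier G; y \<in> carrier G\<rbrakk> \<Longrightarrow> (x \<oslash> y) \<otimes> y = x"

locale loop = quasigroup +
  assumes one_closed: "\<one> \<in> carrier G"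
    and mult_one: "x \<in> carrier G \<Longrightarrow> x \<otimes> \<one> = x"
    and one_mult: "x \<in> carrier G \<Longrightarrow> \<one> \<otimes> x = x"

text \<open>
  \<^const>\<open>auto\<close> consists of the bijections preserving multiplication; an automorphism of the algebra
  respects the whole signature. As in \<^theory>\<open>HOL-Algebra.Bij\<close>, maps on the carrier are represented
  by functions that are \<^const>\<open>undefined\<close> outside it, so that equality of maps is equality in HOL.
\<close>

definition loop_aut :: "('a, 'b) loop_scheme \<Rightarrow> ('a \<Rightarrow> 'a) set" where
  "loop_aut G = {h \<in> auto G. h \<one>\<^bsub>G\<^esub> = \<one>\<^bsub>G\<^esub> \<and>
     (\<forall>x \<in> carrier G. \<forall>y \<in> carrier G.
        h (x \<setminus>\<^bsub>G\<^esub> y) = h x \<setminus>\<^bsub>G\<^esub> h y \<and> h (x \<oslash>\<^bsub>G\<^esub> y) = h x \<oslash>\<^bsub>G\<^esub> h y)}"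

definition autotopisms :: "('a, 'b) loop_scheme \<Rightarrow> (('a \<Rightarrow> 'a) \<times> ('a \<Rightarrow> 'a) \<times> ('a \<Rightarrow> 'a)) set" where
  "autotopisms G = {(\<alpha>, \<beta>, \<gamma>).
     \<alpha> \<in> Bij (carrier G) \<and> \<beta> \<in> Bij (carrier G) \<and> \<gamma> \<in> Bij (carrier G) \<and>
     (\<forall>x \<in> carrier G. \<forall>y \<in> carrier G. \<alpha> x \<otimes>\<^bsub>G\<^esub> \<beta> y = \<gamma> (x \<otimes>\<^bsub>G\<^esub> y))}"

definition Atp :: "('a, 'b) loop_scheme \<Rightarrow> (('a \<Rightarrow> 'a) \<times> ('a \<Rightarrow> 'a) \<times> ('a \<Rightarrow> 'a)) monoid" where
  "Atp G = (BijGroup (carrier G) \<times>\<times> BijGroup (carrier G) \<times>\<times> BijGroup (carrier G))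
             \<lparr>carrier := autotopisms G\<rparr>"

datatype var = X | X0 | Y0

datatype loop_term =
    Var var
  | One
  | Mult loop_term loop_term
  | LDiv loop_term loop_term
  | RDiv loop_term loop_term

primrec occurrences :: "var \<Rightarrow> loop_term \<Rightarrow> nat" where
  "occurrences v (Var w) = (if v = w then 1 else 0)"
| "occurrences v One = 0"
| "occurrences v (Mult s t) = occurrences v s + occurrences v t"
| "occurrences v (LDiv s t) = occurrences v s + occurrences v t"
| "occurrences v (RDiv s t) = occurrences v s + occurrences v t"

primrec eval_term :: "('a, 'b) loop_scheme \<Rightarrow> (var \<Rightarrow> 'a) \<Rightarrow> loop_term \<Rightarrow> 'a" where
  "eval_term G \<rho> (Var v) = \<rho> v"
| "eval_term G \<rho> One = \<one>\<^bsub>G\<^esub>"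
| "eval_term G \<rho> (Mult s t) = eval_term G \<rho> s \<otimes>\<^bsub>G\<^esub> eval_term G \<rho> t"
| "eval_term G \<rho> (LDiv s t) = eval_term G \<rho> s \<setminus>\<^bsub>G\<^esub> eval_term G \<rho> t"
| "eval_term G \<rho> (RDiv s t) = eval_term G \<rho> s \<oslash>\<^bsub>G\<^esub> eval_term G \<rho> t"

definition term_op :: "('a, 'b) loop_scheme \<Rightarrow> loop_term \<Rightarrow> 'a \<Rightarrow> 'a \<Rightarrow> 'a \<Rightarrow> 'a" where
  "term_op G \<eta> x x0 y0 = eval_term G (case_var x x0 y0) \<eta>"

definition in_variety :: "loop_term \<Rightarrow> ('a, 'b) loop_scheme \<Rightarrow> bool" where
  "in_variety \<eta> G \<longleftrightarrow> loop G \<and>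
     (\<forall>x \<in> carrier G. \<forall>y \<in> carrier G. \<forall>x0 \<in> carrier G. \<forall>y0 \<in> carrier G.
        (term_op G \<eta> x x0 y0 \<oslash>\<^bsub>G\<^esub> y0) \<otimes>\<^bsub>G\<^esub> (x0 \<setminus>\<^bsub>G\<^esub> term_op G \<eta> y x0 y0)
          = term_op G \<eta> (x \<otimes>\<^bsub>G\<^esub> y) x0 y0)"

definition Phi :: "('a, 'b) loop_scheme \<Rightarrow> loop_term \<Rightarrow>
    ('a \<Rightarrow> 'a) \<times> 'a \<times> 'a \<Rightarrow> ('a \<Rightarrow> 'a) \<times> ('a \<Rightarrow> 'a) \<times> ('a \<Rightarrow> 'a)" where
  "Phi G \<eta> = (\<lambda>(h, x0, y0).
     (\<lambda>x \<in> carrier G. term_op G \<eta> (h x) x0 y0 \<oslash>\<^bsub>G\<^esub> y0,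
      \<lambda>y \<in> carrier G. x0 \<setminus>\<^bsub>G\<^esub> term_op G \<eta> (h y) x0 y0,
      \<lambda>z \<in> carrier G. term_op G \<eta> (h z) x0 y0))"

definition aut_prod_mult :: "('a, 'b) loop_scheme \<Rightarrow> loop_term \<Rightarrow>
    ('a \<Rightarrow> 'a) \<times> 'a \<times> 'a \<Rightarrow> ('a \<Rightarrow> 'a) \<times> 'a \<times> 'a \<Rightarrow> ('a \<Rightarrow> 'a) \<times> 'a \<times> 'a" where
  "aut_prod_mult G \<eta> = (\<lambda>(h0, x0, y0) (h1, x1, y1).
     let \<phi>0 = (\<lambda>x \<in> carrier G. term_op G \<eta> (h0 x) x0 y0);
         \<phi>1 = (\<lambda>x \<in> carrier G. term_op G \<eta> (h1 x) x1 y1);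
         x2 = \<phi>0 x1 \<oslash>\<^bsub>G\<^esub> y0;
         y2 = x0 \<setminus>\<^bsub>G\<^esub> \<phi>0 y1;
         \<phi>2 = (\<lambda>x \<in> carrier G. term_op G \<eta> x x2 y2);
         h2 = compose (carrier G) (inv_into (carrier G) \<phi>2) (compose (carrier G) \<phi>0 \<phi>1)
     in (h2, x2, y2))"

text \<open>
  The multiplication determines the unit, but the record needs it explicitly. It is not
  \<open>(id, 1, 1)\<close> in general, since \<open>x \<mapsto> \<eta>(x, 1, 1)\<close> can be a nontrivial automorphism: every
  abelian group belongs to \<open>V(\<eta>)\<close> for \<open>\<eta> = x\<^sub>0 \<cdot> ((1/x) \<cdot> y\<^sub>0)\<close>.
\<close>

definition aut_prod :: "('a, 'b) loop_scheme \<Rightarrow> loop_term \<Rightarrow> (('a \<Rightarrow> 'a) \<times> 'a \<times> 'a) monoid" where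
  "aut_prod G \<eta> =
     \<lparr>carrier = loop_aut G \<times> carrier G \<times> carrier G,
      mult = aut_prod_mult G \<eta>,
      one = (\<lambda>x \<in> carrier G. inv_into (carrier G) (\<lambda>x \<in> carrier G. term_op G \<eta> x \<one>\<^bsub>G\<^esub> \<one>\<^bsub>G\<^esub>) x,
             \<one>\<^bsub>G\<^esub>, \<one>\<^bsub>G\<^esub>)\<rparr>"

end

theory Submission
  imports Defs
begin

text \<open>
  Write \<open>T(x\<^sub>0, y\<^sub>0)\<close> for the triple \<open>(\<eta>/y\<^sub>0, x\<^sub>0\<setminus>\<eta>, \<eta>)\<close>. Since \<open>x\<close> occurs exactly once
  in \<open>\<eta>\<close>, its components are bijections, so the identity \<open>i(\<eta>)\<close> says that it is an autotopism; cancelling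
  in the instances \<open>x = 1\<close> and \<open>y = 1\<close> shows that its first two components send \<open>1\<close> to \<open>x\<^sub>0\<close>
  and \<open>y\<^sub>0\<close>. An autotopism \<open>(\<alpha>, \<beta>, \<gamma>)\<close> with \<open>\<alpha>(1) = \<beta>(1) = 1\<close> is \<open>(h, h, h)\<close> for an
  automorphism \<open>h\<close>. Hence every autotopism factors uniquely as
  \<open>T(\<alpha>(1), \<beta>(1)) \<circ> (h, h, h) = \<Phi>(h, \<alpha>(1), \<beta>(1))\<close>. The multiplication on
  \<open>Aut(G) \<times> G\<^sup>2\<close> is \<open>\<Phi>\<^sup>-\<^sup>1(\<Phi>(p) \<Phi>(q))\<close> written out.
\<close>

section \<open>Term operations on quasigroups and loops\<close>

context quasigroup
begin

lemma mult_left_cancel: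
  "\<lbrakk>a \<in> carrier G; x \<in> carrier G; y \<in> carrier G; a \<otimes> x = a \<otimes> y\<rbrakk> \<Longrightarrow> x = y"
  by (metis ldiv_mult)

lemma mult_right_cancel:
  "\<lbrakk>a \<in> carrier G; x \<in> carrier G; y \<in> carrier G; x \<otimes> a = y \<otimes> a\<rbrakk> \<Longrightarrow> x = y"
  by (metis mult_rdiv)

text \<open>Divide \<open>x \<otimes> (x \<setminus> a) = a\<close> on the right by
  \<open>x \<setminus> a\<close>. Together with \<open>ldiv_rdiv\<close> this makes
  \<open>z \<mapsto> z \<setminus> a\<close> and \<open>z \<mapsto> a \<oslash> z\<close> mutually
  inverse.\<close>

lemma rdiv_ldiv: "\<lbrakk>a \<in> carrier G; x \<in> carrier G\<rbrakk> \<Longrightarrow> a \<oslash> (x \<setminus> a) = x"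
  by (metis ldiv_closed mult_ldiv mult_rdiv)

lemma ldiv_rdiv: "\<lbrakk>a \<in> carrier G; x \<in> carrier G\<rbrakk> \<Longrightarrow> (a \<oslash> x) \<setminus> a = x"
  by (metis rdiv_closed rdiv_mult ldiv_mult)

text \<open>These six maps are the ways in which one operation symbol can enclose a subterm while
  its other argument is fixed. The inverse of each is again one of the six.\<close>

lemma bij_betw_translations:
  assumes "a \<in> carrier G"
  shows "bij_betw (\<lambda>x. a \<otimes> x) (carrier G) (carrier G)"
    and "bij_betw (\<lambda>x. x \<otimes> a) (carrier G) (carrier G)"
    and "bij_betw (\<lambda>x. a \<setminus> x) (carrier G) (carrier G)"
    and "bij_betw (\<lambda>x. x \<setminus> a) (carrier G) (carrier G)"
    and "bij_betw (\<lambda>x. a \<oslash> x) (carrier G) (carrier G)"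
    and "bij_betw (\<lambda>x. x \<oslash> a) (carrier G) (carrier G)"
proof -
  note facts = assms mult_closed ldiv_closed rdiv_closed ldiv_mult mult_ldiv mult_rdiv rdiv_mult
    rdiv_ldiv ldiv_rdiv
  show "bij_betw (\<lambda>x. a \<otimes> x) (carrier G) (carrier G)"
    by (rule bij_betw_byWitness[where f' = "\<lambda>x. a \<setminus> x"]) (auto simp: facts)
  show "bij_betw (\<lambda>x. x \<otimes> a) (carrier G) (carrier G)"
    by (rule bij_betw_byWitness[where f' = "\<lambda>x. x \<oslash> a"]) (auto simp: facts)
  show "bij_betw (\<lambda>x. a \<setminus> x) (carrier G) (carrier G)"
    by (rule bij_betw_byWitness[where f' = "\<lambda>x. a \<otimes> x"]) (auto simp: facts)
  show "bij_betw (\<lambda>x. x \<setminus> a) (carrier G) (carrier G)"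
    by (rule bij_betw_byWitness[where f' = "\<lambda>x. a \<oslash> x"]) (auto simp: facts)
  show "bij_betw (\<lambda>x. a \<oslash> x) (carrier G) (carrier G)"
    by (rule bij_betw_byWitness[where f' = "\<lambda>x. x \<setminus> a"]) (auto simp: facts)
  show "bij_betw (\<lambda>x. x \<oslash> a) (carrier G) (carrier G)"
    by (rule bij_betw_byWitness[where f' = "\<lambda>x. x \<otimes> a"]) (auto simp: facts)
qed

end

lemma term_op_cong_not_occurs:
  "occurrences X t = 0 \<Longrightarrow> term_op G t x x0 y0 = term_op G t y x0 y0"
proof (induction t)
  case (Var v)
  then show ?case by (cases v) (simp_all add: term_op_def)
qed (simp_all add: term_op_def)

context loop
begin

lemma term_op_closed:
  assumes "x \<in> carrier G" "x0 \<in> carrier G" "y0 \<in> carrier G"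
  shows "term_op G t x x0 y0 \<in> carrier G"
proof (induction t)
  case (Var v)
  then show ?case using assms by (cases v) (simp_all add: term_op_def)
qed (simp_all add: term_op_def one_closed mult_closed ldiv_closed rdiv_closed)

text \<open>On the path from the root of \<open>t\<close> to the single \<open>X\<close>, every
  operation has a second argument free of \<open>X\<close>. The map is therefore a composite of
  translations.\<close>

lemma bij_betw_term_op:
  assumes "occurrences X t = 1" "x0 \<in> carrier G" "y0 \<in> carrier G"
  shows "bij_betw (\<lambda>x. term_op G t x x0 y0) (carrier G) (carrier G)"
proof -
  \<comment> \<open>The induction step for an arbitrary binary operation \<open>f\<close> with
    bijective translations; multiplication and the two divisions are instances.\<close>
  have binary: "bij_betw (\<lambda>x. f (term_op G s x x0 y0) (term_op G u x x0 y0)) (carrier G) (carrier G)"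
    if left: "\<And>a. a \<in> carrier G \<Longrightarrow> bij_betw (\<lambda>x. f a x) (carrier G) (carrier G)"
      and right: "\<And>a. a \<in> carrier G \<Longrightarrow> bij_betw (\<lambda>x. f x a) (carrier G) (carrier G)"
      and IH: "occurrences X s = 1 \<Longrightarrow> bij_betw (\<lambda>x. term_op G s x x0 y0) (carrier G) (carrier G)"
        "occurrences X u = 1 \<Longrightarrow> bij_betw (\<lambda>x. term_op G u x x0 y0) (carrier G) (carrier G)"
      and occ: "occurrences X s + occurrences X u = 1"
    for f s u
  proof -
    \<comment> \<open>A subterm without \<open>X\<close> is constant in \<open>x\<close>; evaluating
      it at \<open>\<one>\<close>, an arbitrary choice, names its value.\<close>
    have const: "\<And>x. term_op G r x x0 y0 = term_op G r \<one> x0 y0" if "occurrences X r = 0" for r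
      using that by (rule term_op_cong_not_occurs)
    have closed: "term_op G r \<one> x0 y0 \<in> carrier G" for r
      using assms one_closed by (simp add: term_op_closed)
    consider "occurrences X s = 1" "occurrences X u = 0" | "occurrences X s = 0" "occurrences X u = 1"
      using occ by linarith
    then show ?thesis
    proof cases
      case 1
      have "term_op G u x x0 y0 = term_op G u \<one> x0 y0" for x
        using 1(2) by (rule const)
      then have "(\<lambda>x. f (term_op G s x x0 y0) (term_op G u x x0 y0)) =
          (\<lambda>x. f x (term_op G u \<one> x0 y0)) \<circ> (\<lambda>x. term_op G s x x0 y0)"
        by (intro ext) (metis comp_apply)
      then show ?thesis
        using bij_betw_trans[OF IH(1) right[OF closed]] 1 by metis
    next
      case 2
      have "term_op G s x x0 y0 = term_op G s \<one> x0 y0" for x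
        using 2(1) by (rule const)
      then have "(\<lambda>x. f (term_op G s x x0 y0) (term_op G u x x0 y0)) =
          (\<lambda>x. f (term_op G s \<one> x0 y0) x) \<circ> (\<lambda>x. term_op G u x x0 y0)"
        by (intro ext) (metis comp_apply)
      then show ?thesis
        using bij_betw_trans[OF IH(2) left[OF closed]] 2 by metis
    qed
  qed
  show ?thesis
    using assms(1)
  proof (induction t)
    case (Var v)
    then show ?case
      by (cases v) (simp_all add: term_op_def bij_betw_def inj_on_def)
  next
    case One
    then show ?case by simp
  next
    case (Mult s u)
    then show ?case
      using binary[where f = "\<lambda>a b. a \<otimes> b" and s = s and u = u] bij_betw_translations
      by (simp add: term_op_def)
  next
    case (LDiv s u)
    then show ?case
      using binary[where f = "\<lambda>a b. a \<setminus> b" and s = s and u = u] bij_betw_translations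
      by (simp add: term_op_def)
  next
    case (RDiv s u)
    then show ?case
      using binary[where f = "\<lambda>a b. a \<oslash> b" and s = s and u = u] bij_betw_translations
      by (simp add: term_op_def)
  qed
qed

end

section \<open>Autotopisms\<close>

lemma Bij_mem: "\<lbrakk>f \<in> Bij S; x \<in> S\<rbrakk> \<Longrightarrow> f x \<in> S"
  using Bij_imp_funcset by blast

lemma Bij_inv_into_left: "\<lbrakk>f \<in> Bij S; x \<in> S\<rbrakk> \<Longrightarrow> inv_into S f (f x) = x"
  by (auto simp: Bij_def intro: bij_betw_inv_into_left)

lemma Bij_inv_into_right: "\<lbrakk>f \<in> Bij S; x \<in> S\<rbrakk> \<Longrightarrow> f (inv_into S f x) = x"
  by (auto simp: Bij_def intro: bij_betw_inv_into_right)

lemma autotopismsD: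
  assumes "(\<alpha>, \<beta>, \<gamma>) \<in> autotopisms G"
  shows "\<alpha> \<in> Bij (carrier G)" "\<beta> \<in> Bij (carrier G)" "\<gamma> \<in> Bij (carrier G)"
    and "\<lbrakk>x \<in> carrier G; y \<in> carrier G\<rbrakk> \<Longrightarrow> \<gamma> (x \<otimes>\<^bsub>G\<^esub> y) = \<alpha> x \<otimes>\<^bsub>G\<^esub> \<beta> y"
  using assms by (auto simp: autotopisms_def)

lemma Atp_simps:
  "carrier (Atp G) = autotopisms G"
  "\<one>\<^bsub>Atp G\<^esub> = (\<lambda>x \<in> carrier G. x, \<lambda>x \<in> carrier G. x, \<lambda>x \<in> carrier G. x)"
  "\<lbrakk>(a, b, c) \<in> autotopisms G; (a', b', c') \<in> autotopisms G\<rbrakk> \<Longrightarrow>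
    (a, b, c) \<otimes>\<^bsub>Atp G\<^esub> (a', b', c') =
      (compose (carrier G) a a', compose (carrier G) b b', compose (carrier G) c c')"
  by (simp_all add: Atp_def DirProd_def BijGroup_def autotopisms_def)

section \<open>The group of autotopisms\<close>

context quasigroup
begin

lemma autotopisms_compose:
  assumes "(a, b, c) \<in> autotopisms G" "(a', b', c') \<in> autotopisms G"
  shows "(compose (carrier G) a a', compose (carrier G) b b', compose (carrier G) c c') \<in> autotopisms G"
  using assms by (auto simp: autotopisms_def compose_Bij compose_eq Bij_mem mult_closed)

text \<open>Apply the autotopism equation to the preimages of \<open>x\<close> and \<open>y\<close>,
  then cancel \<open>c\<close>. The inverses are restricted because members of \<open>Bij\<close>
  must be undefined outside the carrier.\<close>

lemma autotopisms_inverse: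
  assumes "(a, b, c) \<in> autotopisms G"
  shows "(\<lambda>x \<in> carrier G. inv_into (carrier G) a x, \<lambda>x \<in> carrier G. inv_into (carrier G) b x,
    \<lambda>x \<in> carrier G. inv_into (carrier G) c x) \<in> autotopisms G"
proof -
  note Bij = autotopismsD(1-3)[OF assms]
  have "inv_into (carrier G) a x \<otimes> inv_into (carrier G) b y = inv_into (carrier G) c (x \<otimes> y)"
    if "x \<in> carrier G" "y \<in> carrier G" for x y
  proof -
    let ?x = "inv_into (carrier G) a x" and ?y = "inv_into (carrier G) b y"
    have mem: "?x \<in> carrier G" "?y \<in> carrier G"
      using that Bij by (simp_all add: Bij_inv_into_mem)
    then have "c (?x \<otimes> ?y) = x \<otimes> y"
      using that Bij by (simp add: autotopismsD(4)[OF assms] Bij_inv_into_right)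
    then show ?thesis
      using Bij_inv_into_left[OF Bij(3) mult_closed[OF mem]] by simp
  qed
  then show ?thesis
    using Bij by (auto simp: autotopisms_def restrict_inv_into_Bij mult_closed)
qed

text \<open>The autotopisms form a subgroup of the threefold product of the symmetric group on the
  carrier, so associativity is inherited.\<close>

lemma group_Atp: "group (Atp G)"
proof -
  let ?B = "BijGroup (carrier G)"
  interpret P: group "?B \<times>\<times> ?B \<times>\<times> ?B"
    by (intro DirProd_group group_BijGroup)
  have "subgroup (autotopisms G) (?B \<times>\<times> ?B \<times>\<times> ?B)"
  proof (rule P.subgroupI)
    show "autotopisms G \<subseteq> carrier (?B \<times>\<times> ?B \<times>\<times> ?B)"
      by (auto simp: autotopisms_def BijGroup_def)
    have "(\<lambda>x \<in> carrier G. x, \<lambda>x \<in> carrier G. x, \<lambda>x \<in> carrier G. x) \<in> autotopisms G"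
      by (simp add: autotopisms_def id_Bij mult_closed)
    then show "autotopisms G \<noteq> {}" by blast
  next
    fix t assume t: "t \<in> autotopisms G"
    obtain a b c where abc: "t = (a, b, c)" by (cases t)
    have "a \<in> carrier ?B" "b \<in> carrier ?B" "c \<in> carrier ?B"
      using t by (simp_all add: abc autotopisms_def BijGroup_def)
    then have "inv\<^bsub>?B \<times>\<times> ?B \<times>\<times> ?B\<^esub> t = (inv\<^bsub>?B\<^esub> a, inv\<^bsub>?B\<^esub> b, inv\<^bsub>?B\<^esub> c)"
      by (simp add: abc group_BijGroup DirProd_group)
    then show "inv\<^bsub>?B \<times>\<times> ?B \<times>\<times> ?B\<^esub> t \<in> autotopisms G"
      using autotopisms_inverse[of a b c] autotopismsD[of a b c G] t
      by (simp add: abc inv_BijGroup)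
  next
    fix s t assume st: "s \<in> autotopisms G" "t \<in> autotopisms G"
    obtain a b c where s: "s = (a, b, c)" by (cases s)
    obtain a' b' c' where t: "t = (a', b', c')" by (cases t)
    show "s \<otimes>\<^bsub>?B \<times>\<times> ?B \<times>\<times> ?B\<^esub> t \<in> autotopisms G"
      using autotopisms_compose[of a b c a' b' c'] autotopismsD[of a b c G]
        autotopismsD[of a' b' c' G] st
      by (simp add: s t BijGroup_def)
  qed
  then show ?thesis
    unfolding Atp_def by (rule P.subgroup_imp_group)
qed

end

section \<open>Autotopisms and the identity element of a loop\<close>

context loop
begin

text \<open>Put one argument of the autotopism equation equal to \<open>\<one>\<close> and divide.
  An autotopism is thus determined by \<gamma> and the two values \<alpha>(1) and
  \<beta>(1).\<close>

lemma autotopism_components: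
  assumes t: "(\<alpha>, \<beta>, \<gamma>) \<in> autotopisms G" and x: "x \<in> carrier G"
  shows "\<alpha> x = \<gamma> x \<oslash> \<beta> \<one>" "\<beta> x = \<alpha> \<one> \<setminus> \<gamma> x"
proof -
  have mem: "\<alpha> z \<in> carrier G" "\<beta> z \<in> carrier G" if "z \<in> carrier G" for z
    using autotopismsD[OF t] that by (simp_all add: Bij_mem)
  show "\<alpha> x = \<gamma> x \<oslash> \<beta> \<one>"
    using autotopismsD(4)[OF t x one_closed] mem[OF x] mem[OF one_closed] x
    by (simp add: mult_one mult_rdiv)
  show "\<beta> x = \<alpha> \<one> \<setminus> \<gamma> x"
    using autotopismsD(4)[OF t one_closed x] mem[OF x] mem[OF one_closed] x
    by (simp add: one_mult ldiv_mult)
qed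

lemma loop_aut_of_autotopism:
  assumes t: "(\<alpha>, \<beta>, \<gamma>) \<in> autotopisms G" and one: "\<alpha> \<one> = \<one>" "\<beta> \<one> = \<one>"
  shows "\<gamma> \<in> loop_aut G"
proof -
  note Bij = autotopismsD(1-3)[OF t]
  \<comment> \<open>Setting either argument to \<open>\<one>\<close> identifies all three components
    on the carrier.\<close>
  have "\<alpha> x = \<gamma> x" "\<beta> x = \<gamma> x" if "x \<in> carrier G" for x
    using autotopismsD(4)[OF t that one_closed] autotopismsD(4)[OF t one_closed that] that Bij
    by (simp_all add: one mult_one one_mult Bij_mem)
  then have mult: "\<gamma> (x \<otimes> y) = \<gamma> x \<otimes> \<gamma> y" if "x \<in> carrier G" "y \<in> carrier G" for x y
    using autotopismsD(4)[OF t that] that by simp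
  have mem: "\<gamma> x \<in> carrier G" if "x \<in> carrier G" for x
    using Bij that by (simp add: Bij_mem)
  have "\<gamma> \<one> = \<one>"
    using mult_left_cancel[of "\<gamma> \<one>" "\<gamma> \<one>" \<one>] mult[of \<one> \<one>] mem one_closed by (simp add: mult_one)
  \<comment> \<open>Divisions are determined by multiplication: applying \<gamma> to
    \<open>x \<otimes> (x \<setminus> y) = y\<close> and dividing by \<open>\<gamma> x\<close> gives
    the first equation, and the second is symmetric.\<close>
  moreover have "\<gamma> (x \<setminus> y) = \<gamma> x \<setminus> \<gamma> y" "\<gamma> (x \<oslash> y) = \<gamma> x \<oslash> \<gamma> y"
    if "x \<in> carrier G" "y \<in> carrier G" for x y
    using that mem mult
    by (metis mult_ldiv ldiv_mult ldiv_closed, metis rdiv_mult mult_rdiv rdiv_closed)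
  ultimately show ?thesis
    using Bij(3) mem mult by (simp add: loop_aut_def auto_def hom_def)
qed

end

lemma loop_aut_autotopism: "h \<in> loop_aut G \<Longrightarrow> (h, h, h) \<in> autotopisms G"
  by (auto simp: loop_aut_def auto_def autotopisms_def hom_def)

section \<open>The bijection\<close>

text \<open>The \<open>inv_into\<close> can stay unrestricted: \<gamma> maps the carrier into
  itself, and \<open>compose\<close> already restricts the result.\<close>

definition Phi_inv :: "('a, 'b) loop_scheme \<Rightarrow> loop_term \<Rightarrow>
    ('a \<Rightarrow> 'a) \<times> ('a \<Rightarrow> 'a) \<times> ('a \<Rightarrow> 'a) \<Rightarrow> ('a \<Rightarrow> 'a) \<times> 'a \<times> 'a" where
  "Phi_inv G \<eta> = (\<lambda>(\<alpha>, \<beta>, \<gamma>).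
     (compose (carrier G)
        (inv_into (carrier G) (\<lambda>x \<in> carrier G. term_op G \<eta> x (\<alpha> \<one>\<^bsub>G\<^esub>) (\<beta> \<one>\<^bsub>G\<^esub>))) \<gamma>,
      \<alpha> \<one>\<^bsub>G\<^esub>, \<beta> \<one>\<^bsub>G\<^esub>))"

locale variety_loop = loop +
  fixes \<eta> :: loop_term
  assumes occurrences_X: "occurrences X \<eta> = 1"
    and identity: "\<lbrakk>x \<in> carrier G; y \<in> carrier G; x0 \<in> carrier G; y0 \<in> carrier G\<rbrakk> \<Longrightarrow>
      (term_op G \<eta> x x0 y0 \<oslash> y0) \<otimes> (x0 \<setminus> term_op G \<eta> y x0 y0) = term_op G \<eta> (x \<otimes> y) x0 y0"
begin

lemma param_autotopism:
  assumes "x0 \<in> carrier G" "y0 \<in> carrier G"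
  shows "(\<lambda>x \<in> carrier G. term_op G \<eta> x x0 y0 \<oslash> y0, \<lambda>y \<in> carrier G. x0 \<setminus> term_op G \<eta> y x0 y0,
    \<lambda>z \<in> carrier G. term_op G \<eta> z x0 y0) \<in> autotopisms G"
proof -
  have bij: "bij_betw (\<lambda>x. term_op G \<eta> x x0 y0) (carrier G) (carrier G)"
    using occurrences_X assms by (rule bij_betw_term_op)
  show ?thesis
    using bij bij_betw_trans[OF bij bij_betw_translations(6)[OF assms(2)]]
      bij_betw_trans[OF bij bij_betw_translations(3)[OF assms(1)]] assms
    by (simp add: autotopisms_def Bij_def identity mult_closed o_def)
qed

lemma param_at_one:
  assumes "x0 \<in> carrier G" "y0 \<in> carrier G"
  shows "term_op G \<eta> \<one> x0 y0 \<oslash> y0 = x0" "x0 \<setminus> term_op G \<eta> \<one> x0 y0 = y0"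
proof -
  let ?t = "term_op G \<eta> \<one> x0 y0"
  have t: "?t \<in> carrier G"
    using assms one_closed by (simp add: term_op_closed)
  \<comment> \<open>This is the instance \<open>x = y = \<one>\<close>. Since also
    \<open>x0 \<otimes> (x0 \<setminus> ?t) = ?t\<close>, the common right factor cancels
    below.\<close>
  have "(?t \<oslash> y0) \<otimes> (x0 \<setminus> ?t) = ?t"
    using identity[OF one_closed one_closed assms] by (simp add: mult_one one_closed)
  then show x0: "?t \<oslash> y0 = x0"
    using mult_right_cancel[of "x0 \<setminus> ?t" "?t \<oslash> y0" x0] t assms
    by (simp add: mult_ldiv rdiv_closed ldiv_closed)
  \<comment> \<open>Substitute \<open>x0\<close> for \<open>?t \<oslash> y0\<close> in
    \<open>(?t \<oslash> y0) \<setminus> ?t = y0\<close>.\<close>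
  show "x0 \<setminus> ?t = y0"
    using ldiv_rdiv[OF t assms(2)] by (simp add: x0)
qed

lemma Phi_in_autotopisms:
  assumes "h \<in> loop_aut G" "x0 \<in> carrier G" "y0 \<in> carrier G"
  shows "Phi G \<eta> (h, x0, y0) \<in> autotopisms G"
proof -
  have "h x \<in> carrier G" if "x \<in> carrier G" for x
    using assms(1) that by (auto simp: loop_aut_def auto_def Bij_mem)
  then show ?thesis
    using autotopisms_compose[OF param_autotopism[OF assms(2,3)] loop_aut_autotopism[OF assms(1)]]
    by (simp add: Phi_def compose_def cong: restrict_cong)
qed

text \<open>As \<open>h\<close> fixes \<open>\<one>\<close>, the first two components of the image
  take the values \<open>x0\<close> and \<open>y0\<close> at \<open>\<one>\<close>. Hence
  \<open>Phi_inv\<close> inverts the very map that was applied after \<open>h\<close>.\<close>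

lemma Phi_inv_Phi:
  assumes "h \<in> loop_aut G" "x0 \<in> carrier G" "y0 \<in> carrier G"
  shows "Phi_inv G \<eta> (Phi G \<eta> (h, x0, y0)) = (h, x0, y0)"
proof -
  let ?t = "\<lambda>x \<in> carrier G. term_op G \<eta> x x0 y0"
  have h: "h \<in> Bij (carrier G)" "h \<one> = \<one>"
    using assms(1) by (simp_all add: loop_aut_def auto_def)
  have t: "?t \<in> Bij (carrier G)"
    using param_autotopism[OF assms(2,3)] by (rule autotopismsD)
  have "compose (carrier G) (inv_into (carrier G) ?t) (\<lambda>z \<in> carrier G. term_op G \<eta> (h z) x0 y0) = h"
  proof (rule extensionalityI)
    fix x assume x: "x \<in> carrier G"
    then show "compose (carrier G) (inv_into (carrier G) ?t)
        (\<lambda>z \<in> carrier G. term_op G \<eta> (h z) x0 y0) x = h x"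
      using Bij_inv_into_left[OF t Bij_mem[OF h(1) x]] Bij_mem[OF h(1) x] by (simp add: compose_eq)
  qed (use h in \<open>auto simp: Bij_def\<close>)
  then show ?thesis
    by (simp add: Phi_inv_def Phi_def one_closed h(2) param_at_one assms)
qed

text \<open>Composing the inverse of the parameter triple with \<open>t\<close> gives an autotopism
  whose first two components fix \<open>\<one>\<close>, so its third component is an
  automorphism.\<close>

lemma Phi_inv_mem:
  assumes "t \<in> autotopisms G"
  shows "Phi_inv G \<eta> t \<in> loop_aut G \<times> carrier G \<times> carrier G"
proof -
  obtain \<alpha> \<beta> \<gamma> where t: "t = (\<alpha>, \<beta>, \<gamma>)" by (cases t)
  note aut = assms[unfolded t]
  have mem: "\<alpha> \<one> \<in> carrier G" "\<beta> \<one> \<in> carrier G"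
    using autotopismsD[OF aut] one_closed by (simp_all add: Bij_mem)
  let ?a = "\<lambda>x \<in> carrier G. term_op G \<eta> x (\<alpha> \<one>) (\<beta> \<one>) \<oslash> \<beta> \<one>"
  let ?b = "\<lambda>y \<in> carrier G. \<alpha> \<one> \<setminus> term_op G \<eta> y (\<alpha> \<one>) (\<beta> \<one>)"
  let ?c = "\<lambda>z \<in> carrier G. term_op G \<eta> z (\<alpha> \<one>) (\<beta> \<one>)"
  let ?inv = "\<lambda>f. \<lambda>x \<in> carrier G. inv_into (carrier G) f x"
  note param = param_autotopism[OF mem]
  have "compose (carrier G) (?inv ?a) \<alpha> \<one> = \<one>"
    using Bij_inv_into_left[OF autotopismsD(1)[OF param] one_closed] mem one_closed
    by (simp add: compose_eq param_at_one)
  moreover have "compose (carrier G) (?inv ?b) \<beta> \<one> = \<one>"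
    using Bij_inv_into_left[OF autotopismsD(2)[OF param] one_closed] mem one_closed
    by (simp add: compose_eq param_at_one)
  ultimately have "compose (carrier G) (?inv ?c) \<gamma> \<in> loop_aut G"
    using loop_aut_of_autotopism[OF autotopisms_compose[OF autotopisms_inverse[OF param] aut]] by blast
  \<comment> \<open>The restricted and the plain inverse agree here because \<gamma> takes its
    values in the carrier.\<close>
  moreover have "compose (carrier G) (?inv ?c) \<gamma> = compose (carrier G) (inv_into (carrier G) ?c) \<gamma>"
    using autotopismsD(3)[OF aut] by (auto simp: compose_def Bij_mem intro!: restrict_ext)
  ultimately show ?thesis
    using mem by (simp add: t Phi_inv_def)
qed

text \<open>In the third component the inverse cancels and leaves \<gamma>. The other two then agree
  by \<open>autotopism_components\<close>.\<close>

lemma Phi_Phi_inv: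
  assumes "t \<in> autotopisms G"
  shows "Phi G \<eta> (Phi_inv G \<eta> t) = t"
proof -
  obtain \<alpha> \<beta> \<gamma> where t: "t = (\<alpha>, \<beta>, \<gamma>)" by (cases t)
  note aut = assms[unfolded t]
  note Bij = autotopismsD(1-3)[OF aut]
  have mem: "\<alpha> \<one> \<in> carrier G" "\<beta> \<one> \<in> carrier G"
    using Bij one_closed by (simp_all add: Bij_mem)
  let ?c = "\<lambda>z \<in> carrier G. term_op G \<eta> z (\<alpha> \<one>) (\<beta> \<one>)"
  note c = autotopismsD(3)[OF param_autotopism[OF mem]]
  have "term_op G \<eta> (inv_into (carrier G) ?c (\<gamma> x)) (\<alpha> \<one>) (\<beta> \<one>) = \<gamma> x" if "x \<in> carrier G" for x
    using Bij_inv_into_right[OF c Bij_mem[OF Bij(3) that]]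
      Bij_inv_into_mem[OF c Bij_mem[OF Bij(3) that]] by simp
  then show ?thesis
    using Bij unfolding t
    by (auto simp: Phi_def Phi_inv_def compose_eq Bij_def autotopism_components(1)[OF aut]
        autotopism_components(2)[OF aut] intro!: extensionalityI[where A = "carrier G"])
qed

lemma bij_betw_Phi:
  "bij_betw (Phi G \<eta>) (loop_aut G \<times> carrier G \<times> carrier G) (autotopisms G)"
proof (rule bij_betw_byWitness[where f' = "Phi_inv G \<eta>"])
  show "Phi_inv G \<eta> ` autotopisms G \<subseteq> loop_aut G \<times> carrier G \<times> carrier G"
    using Phi_inv_mem by (rule image_subsetI)
qed (auto simp: Phi_inv_Phi Phi_Phi_inv Phi_in_autotopisms)

lemma inv_into_Phi:
  assumes "t \<in> autotopisms G"
  shows "inv_into (loop_aut G \<times> carrier G \<times> carrier G) (Phi G \<eta>) t = Phi_inv G \<eta> t"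
  using bij_betw_Phi Phi_inv_mem[OF assms] Phi_Phi_inv[OF assms]
  by (simp add: bij_betw_def inv_into_f_eq)

section \<open>The isomorphism\<close>

text \<open>Since \<open>h1\<close> fixes \<open>\<one>\<close>, the second factor sends
  \<open>\<one>\<close> to \<open>x1\<close> and \<open>y1\<close> in its first two components. The
  first factor carries these to the new parameters, and the third component of the product is the
  composite of the two \<phi> maps.\<close>

lemma aut_prod_mult_eq:
  assumes "h0 \<in> loop_aut G" "x0 \<in> carrier G" "y0 \<in> carrier G"
    and "h1 \<in> loop_aut G" "x1 \<in> carrier G" "y1 \<in> carrier G"
  shows "aut_prod_mult G \<eta> (h0, x0, y0) (h1, x1, y1) =
    Phi_inv G \<eta> (Phi G \<eta> (h0, x0, y0) \<otimes>\<^bsub>Atp G\<^esub> Phi G \<eta> (h1, x1, y1))"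
proof -
  have "h1 \<one> = \<one>"
    using assms(4) by (simp add: loop_aut_def)
  then show ?thesis
    using Phi_in_autotopisms[OF assms(1-3)] Phi_in_autotopisms[OF assms(4-6)] assms
    by (simp add: Phi_def Atp_simps Phi_inv_def aut_prod_mult_def Let_def compose_eq one_closed
        param_at_one)
qed

lemma Phi_iso: "Phi G \<eta> \<in> iso (aut_prod G \<eta>) (Atp G)"
proof -
  interpret Atp: group "Atp G" by (rule group_Atp)
  have "Phi G \<eta> (p \<otimes>\<^bsub>aut_prod G \<eta>\<^esub> q) = Phi G \<eta> p \<otimes>\<^bsub>Atp G\<^esub> Phi G \<eta> q"
    if "p \<in> carrier (aut_prod G \<eta>)" "q \<in> carrier (aut_prod G \<eta>)" for p q
  proof -
    obtain h0 x0 y0 h1 x1 y1 where pq: "p = (h0, x0, y0)" "q = (h1, x1, y1)"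
      by (cases p, cases q)
    \<comment> \<open>Membership of the product is what lets \<open>Phi_Phi_inv\<close> cancel the
      \<open>Phi_inv\<close> in \<open>aut_prod_mult_eq\<close>.\<close>
    have "Phi G \<eta> p \<otimes>\<^bsub>Atp G\<^esub> Phi G \<eta> q \<in> autotopisms G"
      using that Atp.m_closed by (auto simp: pq aut_prod_def Phi_in_autotopisms Atp_simps)
    then show ?thesis
      using that by (simp add: pq aut_prod_def aut_prod_mult_eq Phi_Phi_inv)
  qed
  moreover have "Phi G \<eta> p \<in> carrier (Atp G)" if "p \<in> carrier (aut_prod G \<eta>)" for p
    using that by (auto simp: aut_prod_def Phi_in_autotopisms Atp_simps)
  ultimately show ?thesis
    using bij_betw_Phi by (simp add: iso_def hom_def Atp_simps(1)) (simp add: aut_prod_def)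
qed

text \<open>The identity triple has both parameters equal to \<open>\<one>\<close>, so its
  automorphism part is the inverse of \<open>x \<mapsto> \<eta>(x, 1, 1)\<close>. This justifies the
  unit chosen in \<open>aut_prod\<close>.\<close>

lemma Phi_inv_one: "Phi_inv G \<eta> \<one>\<^bsub>Atp G\<^esub> = \<one>\<^bsub>aut_prod G \<eta>\<^esub>"
  by (auto simp: Phi_inv_def Atp_simps aut_prod_def one_closed compose_def intro!: restrict_ext)

text \<open>The group axioms are transported from \<open>Atp G\<close> along \<open>Phi_inv\<close>,
  which avoids verifying associativity of the explicit multiplication.\<close>

lemma group_aut_prod: "group (aut_prod G \<eta>)"
proof -
  interpret Atp: group "Atp G" by (rule group_Atp)
  have mult: "Phi_inv G \<eta> (s \<otimes>\<^bsub>Atp G\<^esub> t) = Phi_inv G \<eta> s \<otimes>\<^bsub>aut_prod G \<eta>\<^esub> Phi_inv G \<eta> t"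
    if "s \<in> autotopisms G" "t \<in> autotopisms G" for s t
  proof -
    obtain h0 x0 y0 h1 x1 y1 where
      st: "Phi_inv G \<eta> s = (h0, x0, y0)" "Phi_inv G \<eta> t = (h1, x1, y1)"
      by (cases "Phi_inv G \<eta> s", cases "Phi_inv G \<eta> t")
    then show ?thesis
      using Phi_inv_mem[OF that(1)] Phi_inv_mem[OF that(2)] Phi_Phi_inv[OF that(1)]
        Phi_Phi_inv[OF that(2)]
      by (simp add: aut_prod_def aut_prod_mult_eq)
  qed
  have "bij_betw (Phi_inv G \<eta>) (autotopisms G) (loop_aut G \<times> carrier G \<times> carrier G)"
    using bij_betw_inv_into[OF bij_betw_Phi] by (simp add: inv_into_Phi cong: bij_betw_cong)
  then have "Phi_inv G \<eta> \<in> iso (Atp G) (aut_prod G \<eta>)"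
    using mult Phi_inv_mem by (simp add: iso_def hom_def Atp_simps(1)) (simp add: aut_prod_def)
  \<comment> \<open>Transport yields a group whose unit is the image of the old unit; by
    \<open>Phi_inv_one\<close> this record update changes nothing.\<close>
  then have "group (aut_prod G \<eta>\<lparr>one := Phi_inv G \<eta> \<one>\<^bsub>Atp G\<^esub>\<rparr>)"
    by (rule Atp.iso_imp_img_group)
  then show ?thesis
    by (simp add: Phi_inv_one)
qed

end

theorem proposition2p2:
  fixes G :: "('a, 'b) loop_scheme" and \<eta> :: loop_term
  assumes "occurrences X \<eta> = 1"
    and "in_variety \<eta> G"
  shows "bij_betw (Phi G \<eta>) (loop_aut G \<times> carrier G \<times> carrier G) (autotopisms G)
    \<and> group (aut_prod G \<eta>) \<and> group (Atp G)
    \<and> Phi G \<eta> \<in> iso (aut_prod G \<eta>) (Atp G)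
    \<and> (\<forall>(\<alpha>, \<beta>, \<gamma>) \<in> autotopisms G.
         let h0 = (\<lambda>x \<in> carrier G. term_op G \<eta> x (\<alpha> \<one>\<^bsub>G\<^esub>) (\<beta> \<one>\<^bsub>G\<^esub>))
         in inv_into (loop_aut G \<times> carrier G \<times> carrier G) (Phi G \<eta>) (\<alpha>, \<beta>, \<gamma>)
              = (compose (carrier G) (inv_into (carrier G) h0) \<gamma>, \<alpha> \<one>\<^bsub>G\<^esub>, \<beta> \<one>\<^bsub>G\<^esub>))"
proof -
  interpret variety_loop G \<eta>
    using assms by (auto simp: in_variety_def variety_loop_def variety_loop_axioms_def)
  show ?thesis
    using bij_betw_Phi group_aut_prod group_Atp Phi_iso
    by (auto simp: inv_into_Phi Phi_inv_def Let_def)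
qed

end
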